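(* Let $F$ be a field of characteristic $0$. The pre-Jordan product $x\cdot y = x\succ y + y\prec x$ in the free dendriform algebra over $F$ satisfies no (nonzero) multilinear polynomial identities in degree $3$. Equivalently, the expansion map $\mathcal{E}_3\colon A_3\to B_3$ is injective.
   Context: A dendriform algebra over $F$ is a vector space with two bilinear operations $\succ,\prec$ satisfying, for all $x,y,z$: $(x\prec y)\prec z = x\prec(y\prec z)+x\prec(y\succ z)$; $(x\succ y)\prec z = x\succ(y\prec z)$; $x\succ(y\succ z) = (x\prec y)\succ z+(x\succ y)\succ z$. Let $A_n$ be the space of multilinear polynomials of degree $n$ in $x_1,\dots,x_n$ in the free nonassociative (nonunital) $F$-algebra with one bilinear operation $x\cdot y$ on $x_1,\dots,x_n$, and let $B_n$ be the space of multilinear elements of degree $n$ in $x_1,\dots,x_n$ in the free dendriform $F$-algebra on $x_1,\dots,x_n$. The expansion map $\mathcal{E}_n\colon A_n\to B_n$ is the linear map that replaces every occurrence of the product $x\cdot y$ by $x\succ y+y\prec x$. The multilinear identities of degree $n$ satisfied by the pre-Jordan product are the elements of $\ker\mathcal{E}_n$. *)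

theory Defs
  imports Complex_Main "HOL-Library.Poly_Mapping" "HOL-Library.Multiset" "HOL-Library.Numeral_Type"
begin

section \<open>Free algebras with a family of bilinear operations\<close>

text \<open>Monomials in the generators \<open>'v\<close>, with one binary operation for each element of \<open>'o\<close>.
  There is no empty monomial, so the algebras below are nonunital.\<close>

datatype ('o, 'v) monomial = Gen 'v | Op 'o "('o, 'v) monomial" "('o, 'v) monomial"

primrec gens :: "('o, 'v) monomial \<Rightarrow> 'v multiset" where
  "gens (Gen v) = {#v#}"
| "gens (Op b s t) = gens s + gens t"

text \<open>The free algebra is the space of finitely supported functions on monomials.\<close>

type_synonym ('o, 'v, 'f) free_algebra = "('o, 'v) monomial \<Rightarrow>\<^sub>0 'f"

definition smul :: "'f \<Rightarrow> ('k \<Rightarrow>\<^sub>0 'f) \<Rightarrow> ('k \<Rightarrow>\<^sub>0 'f::field)" where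
  "smul c p = Poly_Mapping.map ((*) c) p"

text \<open>\<open>linear_extension scale f\<close> is the linear map, into a space with scalar multiplication
  \<open>scale\<close>, that takes the value \<open>f k\<close> on the basis vector \<open>k\<close>.\<close>

definition linear_extension ::
  "('f \<Rightarrow> 'a \<Rightarrow> 'a) \<Rightarrow> ('k \<Rightarrow> 'a) \<Rightarrow> ('k \<Rightarrow>\<^sub>0 'f::field) \<Rightarrow> 'a::ab_group_add" where
  "linear_extension scale f p = (\<Sum>k\<in>Poly_Mapping.keys p. scale (Poly_Mapping.lookup p k) (f k))"

definition generator :: "'v \<Rightarrow> ('o, 'v, 'f::field) free_algebra" where
  "generator v = Poly_Mapping.single (Gen v) 1"

definition operation :: "'o \<Rightarrow> ('o, 'v, 'f::field) free_algebra \<Rightarrow> ('o, 'v, 'f) free_algebra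
    \<Rightarrow> ('o, 'v, 'f) free_algebra" where
  "operation b p q =
     linear_extension smul (\<lambda>s. linear_extension smul (\<lambda>t. Poly_Mapping.single (Op b s t) 1) q) p"

text \<open>The elements that are linear in each generator. If \<open>'v\<close> has exactly \<open>n\<close> elements,
  these are the multilinear polynomials of degree \<open>n\<close> in \<open>n\<close> generators.\<close>

definition multilinear :: "('o, 'v::finite, 'f::field) free_algebra set" where
  "multilinear = {p. \<forall>t\<in>Poly_Mapping.keys p. \<forall>v. count (gens t) v = 1}"

lemma lookup_smul [simp]: "Poly_Mapping.lookup (smul c p) k = c * Poly_Mapping.lookup p k"
  by (auto simp: smul_def Poly_Mapping.map.rep_eq when_def)

lemma vector_space_smul: "vector_space (smul :: 'f::field \<Rightarrow> ('k \<Rightarrow>\<^sub>0 'f) \<Rightarrow> _)"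
  by standard (auto intro!: poly_mapping_eqI simp: lookup_add algebra_simps)

interpretation smul: vector_space "smul :: 'f::field \<Rightarrow> ('k \<Rightarrow>\<^sub>0 'f) \<Rightarrow> _"
  by (rule vector_space_smul)

lemma linear_extension_superset:
  assumes "vector_space scale" "finite A" "Poly_Mapping.keys p \<subseteq> A"
  shows "linear_extension scale f p = (\<Sum>k\<in>A. scale (Poly_Mapping.lookup p k) (f k))"
proof -
  interpret vector_space scale by fact
  show ?thesis
    unfolding linear_extension_def using assms
    by (intro sum.mono_neutral_left) (auto simp: in_keys_iff)
qed

lemma linearI:
  assumes "vector_space s1" "vector_space s2"
    and "\<And>x y. f (x + y) = f x + f y" "\<And>c x. f (s1 c x) = s2 c (f x)"
  shows "Vector_Spaces.linear s1 s2 f"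
  using assms
  by (simp add: Vector_Spaces.linear_def module_hom_def module_hom_axioms_def module_iff_vector_space)

lemma linear_linear_extension:
  assumes "vector_space scale"
  shows "Vector_Spaces.linear smul scale (linear_extension scale f)"
proof (rule linearI[OF vector_space_smul assms])
  interpret vector_space scale by fact
  fix p q :: "'c \<Rightarrow>\<^sub>0 'a" and c
  let ?A = "Poly_Mapping.keys p \<union> Poly_Mapping.keys q"
  have "Poly_Mapping.keys (p + q) \<subseteq> ?A" by (rule keys_add)
  then show "linear_extension scale f (p + q) = linear_extension scale f p + linear_extension scale f q"
    using assms by (simp add: linear_extension_superset[where A = ?A] lookup_add scale_left_distrib
        sum.distrib)
  have "Poly_Mapping.keys (smul c p) \<subseteq> Poly_Mapping.keys p" by (auto simp: in_keys_iff)
  then show "linear_extension scale f (smul c p) = scale c (linear_extension scale f p)"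
    using assms by (simp add: linear_extension_superset[where A = "Poly_Mapping.keys p"]
        scale_sum_right)
qed

lemma linear_extension_single [simp]:
  assumes "vector_space scale"
  shows "linear_extension scale f (Poly_Mapping.single k c) = scale c (f k)"
proof -
  interpret vector_space scale by fact
  show ?thesis by (simp add: linear_extension_def)
qed

lemma linear_extension_unique:
  assumes "Vector_Spaces.linear smul scale h"
  shows "h p = linear_extension scale (\<lambda>k. h (Poly_Mapping.single k 1)) p"
proof -
  interpret Vector_Spaces.linear smul scale h by fact
  have "p = (\<Sum>k\<in>Poly_Mapping.keys p. smul (Poly_Mapping.lookup p k) (Poly_Mapping.single k 1))"
    by (rule poly_mapping_eqI)
       (simp add: lookup_sum lookup_single when_def sum.delta not_in_keys_iff_lookup_eq_zero if_distrib cong: if_cong)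
  then have "h p = h (\<Sum>k\<in>Poly_Mapping.keys p. smul (Poly_Mapping.lookup p k) (Poly_Mapping.single k 1))"
    by simp
  also have "\<dots> = linear_extension scale (\<lambda>k. h (Poly_Mapping.single k 1)) p"
    by (simp add: sum scale linear_extension_def)
  finally show ?thesis .
qed

lemma linear_operation_left: "Vector_Spaces.linear smul smul (\<lambda>p. operation b p q)"
  unfolding operation_def by (rule linear_linear_extension[OF vector_space_smul])

lemma linear_operation_right: "Vector_Spaces.linear smul smul (operation b p)"
proof (rule linearI[OF vector_space_smul vector_space_smul])
  note lin = linear_linear_extension[OF vector_space_smul]
  note add = Vector_Spaces.linear.axioms(3)[OF lin, THEN module_hom.add]
  note sc = Vector_Spaces.linear.axioms(3)[OF lin, THEN module_hom.scale]
  fix q r c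
  show "operation b p (q + r) = operation b p q + operation b p r"
    by (simp add: operation_def add, simp add: linear_extension_def smul.scale_right_distrib sum.distrib)
  show "operation b p (smul c q) = smul c (operation b p q)"
    by (simp add: operation_def sc, simp add: linear_extension_def smul.scale_sum_right mult.left_commute)
qed

lemma operation_single [simp]:
  "operation b (Poly_Mapping.single s c) (Poly_Mapping.single t d)
     = Poly_Mapping.single (Op b s t) (c * d)"
  by (rule poly_mapping_eqI) (simp add: operation_def vector_space_smul lookup_single when_def)


section \<open>Dendriform algebras\<close>

locale dendriform_algebra = vector_space scale
  for scale :: "'f::field \<Rightarrow> 'a::ab_group_add \<Rightarrow> 'a" +
  fixes succ :: "'a \<Rightarrow> 'a \<Rightarrow> 'a" (infixl \<open>\<succ>\<close> 70)
    and prec :: "'a \<Rightarrow> 'a \<Rightarrow> 'a" (infixl \<open>\<prec>\<close> 70)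
  assumes succ_linear_left: "Vector_Spaces.linear scale scale (\<lambda>x. x \<succ> y)"
    and succ_linear_right: "Vector_Spaces.linear scale scale (\<lambda>y. x \<succ> y)"
    and prec_linear_left: "Vector_Spaces.linear scale scale (\<lambda>x. x \<prec> y)"
    and prec_linear_right: "Vector_Spaces.linear scale scale (\<lambda>y. x \<prec> y)"
    and prec_prec: "(x \<prec> y) \<prec> z = x \<prec> (y \<prec> z) + x \<prec> (y \<succ> z)"
    and succ_prec: "(x \<succ> y) \<prec> z = x \<succ> (y \<prec> z)"
    and succ_succ: "x \<succ> (y \<succ> z) = (x \<prec> y) \<succ> z + (x \<succ> y) \<succ> z"

datatype dendriform_op = Succ | Prec

inductive_set dendriform_ideal :: "(dendriform_op, 'v, 'f::field) free_algebra set" where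
  prec_prec: "operation Prec (operation Prec p q) r
      - (operation Prec p (operation Prec q r) + operation Prec p (operation Succ q r))
      \<in> dendriform_ideal"
| succ_prec: "operation Prec (operation Succ p q) r - operation Succ p (operation Prec q r)
      \<in> dendriform_ideal"
| succ_succ: "operation Succ p (operation Succ q r)
      - (operation Succ (operation Prec p q) r + operation Succ (operation Succ p q) r)
      \<in> dendriform_ideal"
| zero: "0 \<in> dendriform_ideal"
| add: "p \<in> dendriform_ideal \<Longrightarrow> q \<in> dendriform_ideal \<Longrightarrow> p + q \<in> dendriform_ideal"
| smul: "p \<in> dendriform_ideal \<Longrightarrow> smul c p \<in> dendriform_ideal"
| left: "p \<in> dendriform_ideal \<Longrightarrow> operation b q p \<in> dendriform_ideal"
| right: "p \<in> dendriform_ideal \<Longrightarrow> operation b p q \<in> dendriform_ideal"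

lemma dendriform_ideal_uminus: "p \<in> dendriform_ideal \<Longrightarrow> - p \<in> dendriform_ideal"
  using dendriform_ideal.smul[of p "-1"] by simp

lemma dendriform_ideal_diff:
  "p \<in> dendriform_ideal \<Longrightarrow> q \<in> dendriform_ideal \<Longrightarrow> p - q \<in> dendriform_ideal"
  using dendriform_ideal.add[OF _ dendriform_ideal_uminus, of p q] by simp

quotient_type (overloaded) ('v, 'f) free_dendriform = "(dendriform_op, 'v, 'f::field) free_algebra"
  / "\<lambda>p q. p - q \<in> dendriform_ideal"
proof (rule equivpI)
  show "reflp (\<lambda>p q :: (dendriform_op, 'v, 'f) free_algebra. p - q \<in> dendriform_ideal)"
    by (auto intro!: reflpI dendriform_ideal.zero)
  show "symp (\<lambda>p q :: (dendriform_op, 'v, 'f) free_algebra. p - q \<in> dendriform_ideal)"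
    by (rule sympI) (drule dendriform_ideal_uminus, simp)
  show "transp (\<lambda>p q :: (dendriform_op, 'v, 'f) free_algebra. p - q \<in> dendriform_ideal)"
    by (rule transpI) (drule (1) dendriform_ideal.add, simp)
qed

instantiation free_dendriform :: (type, field) ab_group_add
begin

lift_definition zero_free_dendriform :: "('a, 'b) free_dendriform" is 0 .

lift_definition plus_free_dendriform ::
  "('a, 'b) free_dendriform \<Rightarrow> ('a, 'b) free_dendriform \<Rightarrow> ('a, 'b) free_dendriform" is "(+)"
  by (drule (1) dendriform_ideal.add) (simp add: algebra_simps)

lift_definition uminus_free_dendriform ::
  "('a, 'b) free_dendriform \<Rightarrow> ('a, 'b) free_dendriform" is uminus
  by (drule dendriform_ideal_uminus) simp

lift_definition minus_free_dendriform ::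
  "('a, 'b) free_dendriform \<Rightarrow> ('a, 'b) free_dendriform \<Rightarrow> ('a, 'b) free_dendriform" is "(-)"
  by (drule (1) dendriform_ideal_diff) (simp add: algebra_simps)

instance
  by standard (transfer, simp add: algebra_simps dendriform_ideal.zero)+

end

lift_definition dend_scale ::
  "'f \<Rightarrow> ('v, 'f::field) free_dendriform \<Rightarrow> ('v, 'f) free_dendriform" is smul
  by (drule dendriform_ideal.smul) (simp add: smul.scale_right_diff_distrib)

lift_definition dend_gen :: "'v \<Rightarrow> ('v, 'f::field) free_dendriform" is generator .

lemma operation_diff_left: "operation b (p - p') q = operation b p q - operation b p' q"
  by (rule module_hom.diff[OF Vector_Spaces.linear.axioms(3)[OF linear_operation_left]])

lemma operation_diff_right: "operation b p (q - q') = operation b p q - operation b p q'"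
  by (rule module_hom.diff[OF Vector_Spaces.linear.axioms(3)[OF linear_operation_right]])

lemma operation_congruent:
  assumes "p - p' \<in> dendriform_ideal" "q - q' \<in> dendriform_ideal"
  shows "operation b p q - operation b p' q' \<in> dendriform_ideal"
proof -
  have "operation b p q - operation b p' q' = operation b (p - p') q + operation b p' (q - q')"
    by (simp add: operation_diff_left operation_diff_right)
  then show ?thesis
    using assms by (simp add: dendriform_ideal.add dendriform_ideal.left dendriform_ideal.right)
qed

lift_definition dend_op :: "dendriform_op \<Rightarrow> ('v, 'f::field) free_dendriform
    \<Rightarrow> ('v, 'f) free_dendriform \<Rightarrow> ('v, 'f) free_dendriform" is operation
  by (rule operation_congruent)

abbreviation dend_succ (infixl \<open>\<succ>\<^sub>D\<close> 70) where "x \<succ>\<^sub>D y \<equiv> dend_op Succ x y"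
abbreviation dend_prec (infixl \<open>\<prec>\<^sub>D\<close> 70) where "x \<prec>\<^sub>D y \<equiv> dend_op Prec x y"

lemma vector_space_dend_scale:
  "vector_space (dend_scale :: 'f::field \<Rightarrow> ('v, 'f) free_dendriform \<Rightarrow> _)"
  by standard
    (transfer, simp add: smul.scale_right_distrib smul.scale_left_distrib dendriform_ideal.zero)+

lemma linear_dend_op_left: "Vector_Spaces.linear dend_scale dend_scale (\<lambda>x. dend_op b x y)"
proof (rule linearI[OF vector_space_dend_scale vector_space_dend_scale])
  note hom = Vector_Spaces.linear.axioms(3)[OF linear_operation_left]
  fix x x' c
  show "dend_op b (x + x') y = dend_op b x y + dend_op b x' y"
    by transfer (simp add: module_hom.add[OF hom] dendriform_ideal.zero)
  show "dend_op b (dend_scale c x) y = dend_scale c (dend_op b x y)"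
    by transfer (simp add: module_hom.scale[OF hom] dendriform_ideal.zero)
qed

lemma linear_dend_op_right: "Vector_Spaces.linear dend_scale dend_scale (dend_op b x)"
proof (rule linearI[OF vector_space_dend_scale vector_space_dend_scale])
  note hom = Vector_Spaces.linear.axioms(3)[OF linear_operation_right]
  fix y y' c
  show "dend_op b x (y + y') = dend_op b x y + dend_op b x y'"
    by transfer (simp add: module_hom.add[OF hom] dendriform_ideal.zero)
  show "dend_op b x (dend_scale c y) = dend_scale c (dend_op b x y)"
    by transfer (simp add: module_hom.scale[OF hom] dendriform_ideal.zero)
qed

theorem dendriform_algebra_free_dendriform:
  "dendriform_algebra (dend_scale :: 'f::field \<Rightarrow> ('v, 'f) free_dendriform \<Rightarrow> _) (\<succ>\<^sub>D) (\<prec>\<^sub>D)"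
proof (intro dendriform_algebra.intro dendriform_algebra_axioms.intro vector_space_dend_scale
    linear_dend_op_left linear_dend_op_right)
  fix x y z :: "('v, 'f) free_dendriform"
  show "(x \<prec>\<^sub>D y) \<prec>\<^sub>D z = x \<prec>\<^sub>D (y \<prec>\<^sub>D z) + x \<prec>\<^sub>D (y \<succ>\<^sub>D z)"
    by transfer (rule dendriform_ideal.prec_prec)
  show "(x \<succ>\<^sub>D y) \<prec>\<^sub>D z = x \<succ>\<^sub>D (y \<prec>\<^sub>D z)"
    by transfer (rule dendriform_ideal.succ_prec)
  show "x \<succ>\<^sub>D (y \<succ>\<^sub>D z) = (x \<prec>\<^sub>D y) \<succ>\<^sub>D z + (x \<succ>\<^sub>D y) \<succ>\<^sub>D z"
    by transfer (rule dendriform_ideal.succ_succ)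
qed

text \<open>The universal property: every map from the generators into a dendriform algebra extends to
  a unique homomorphism.\<close>

primrec eval_monomial ::
  "('v \<Rightarrow> 'a) \<Rightarrow> (dendriform_op \<Rightarrow> 'a \<Rightarrow> 'a \<Rightarrow> 'a) \<Rightarrow> (dendriform_op, 'v) monomial \<Rightarrow> 'a" where
  "eval_monomial f m (Gen v) = f v"
| "eval_monomial f m (Op b s t) = m b (eval_monomial f m s) (eval_monomial f m t)"

definition dendriform_hom :: "('f::field \<Rightarrow> 'a \<Rightarrow> 'a) \<Rightarrow> ('a \<Rightarrow> 'a \<Rightarrow> 'a) \<Rightarrow> ('a \<Rightarrow> 'a \<Rightarrow> 'a)
    \<Rightarrow> (('v, 'f) free_dendriform \<Rightarrow> 'a::ab_group_add) \<Rightarrow> bool" where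
  "dendriform_hom scale succ prec h \<longleftrightarrow> Vector_Spaces.linear dend_scale scale h
     \<and> (\<forall>x y. h (x \<succ>\<^sub>D y) = succ (h x) (h y)) \<and> (\<forall>x y. h (x \<prec>\<^sub>D y) = prec (h x) (h y))"

lemma linear_extension_operation:
  assumes "vector_space scale"
    and left: "\<And>y. Vector_Spaces.linear scale scale (\<lambda>x. m x y)"
    and right: "\<And>x. Vector_Spaces.linear scale scale (m x)"
    and ev: "\<And>s t. ev (Op b s t) = m (ev s) (ev t)"
  shows "linear_extension scale ev (operation b p q)
    = m (linear_extension scale ev p) (linear_extension scale ev q)"
proof -
  let ?H = "linear_extension scale ev"
  interpret vector_space scale by fact
  interpret H: Vector_Spaces.linear smul scale ?H
    by (rule linear_linear_extension) fact
  interpret L: Vector_Spaces.linear scale scale "\<lambda>x. m x y" for y by (rule left)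
  interpret R: Vector_Spaces.linear scale scale "m x" for x by (rule right)
  have "?H (operation b p q) = (\<Sum>s\<in>Poly_Mapping.keys p. \<Sum>t\<in>Poly_Mapping.keys q.
      scale (Poly_Mapping.lookup p s) (scale (Poly_Mapping.lookup q t) (m (ev s) (ev t))))"
    unfolding operation_def linear_extension_def[of smul]
    by (simp add: H.sum H.scale scale_sum_right ev linear_extension_single[OF assms(1)]
        del: scale_scale)
  also have "\<dots> = m (?H p) (?H q)"
    unfolding linear_extension_def
    by (subst sum.swap) (simp add: L.sum L.scale R.sum R.scale scale_sum_right scale_left_commute
        del: scale_scale)
  finally show ?thesis .
qed

theorem free_dendriform_universal:
  fixes f :: "'v \<Rightarrow> 'a::ab_group_add" and scale :: "'f::field \<Rightarrow> 'a \<Rightarrow> 'a"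
  assumes "dendriform_algebra scale succ prec"
  shows "\<exists>!h :: ('v, 'f) free_dendriform \<Rightarrow> 'a.
    dendriform_hom scale succ prec h \<and> (\<forall>v. h (dend_gen v) = f v)"
proof (rule ex_ex1I)
  interpret D: dendriform_algebra scale succ prec by fact
  have vs: "vector_space scale" by (rule D.vector_space_axioms)
  define m where "m = (\<lambda>b. case b of Succ \<Rightarrow> succ | Prec \<Rightarrow> prec)"
  have m_simps [simp]: "m Succ = succ" "m Prec = prec" by (simp_all add: m_def)
  have left: "Vector_Spaces.linear scale scale (\<lambda>x. m b x y)" for b y
    by (cases b) (simp_all add: D.succ_linear_left D.prec_linear_left)
  have right: "Vector_Spaces.linear scale scale (m b x)" for b x
    by (cases b) (simp_all add: D.succ_linear_right D.prec_linear_right)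
  define H where "H = linear_extension scale (eval_monomial f m)"
  have "Vector_Spaces.linear smul scale H"
    unfolding H_def by (rule linear_linear_extension[OF vs])
  then interpret H: Vector_Spaces.linear smul scale H .
  have H_op: "H (operation b p q) = m b (H p) (H q)" for b p q
    unfolding H_def by (rule linear_extension_operation[OF vs left right]) simp
  interpret L: Vector_Spaces.linear scale scale "\<lambda>x. m b x y" for b y by (rule left)
  interpret R: Vector_Spaces.linear scale scale "m b x" for b x by (rule right)
  have H_ideal: "H p = 0" if "p \<in> dendriform_ideal" for p
    using that
    by induction
      (simp_all add: H.add H.diff H.scale H.zero H_op L.zero R.zero
        D.prec_prec D.succ_prec D.succ_succ)
  define h where "h x = H (rep_free_dendriform x)" for x
  have h_abs: "h (abs_free_dendriform p) = H p" for p
  proof -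
    have "rep_free_dendriform (abs_free_dendriform p) - p \<in> dendriform_ideal"
      using Quotient3_free_dendriform by (rule rep_abs_rsp_left) (simp add: dendriform_ideal.zero)
    from H_ideal[OF this] show ?thesis by (simp add: h_def H.diff)
  qed
  have "Vector_Spaces.linear dend_scale scale h"
  proof (rule linearI[OF vector_space_dend_scale vs])
    fix x y c
    show "h (x + y) = h x + h y"
      by (induction x; induction y)
        (simp add: plus_free_dendriform.abs_eq h_abs H.add)
    show "h (dend_scale c x) = scale c (h x)"
      by (induction x) (simp add: dend_scale.abs_eq h_abs H.scale)
  qed
  moreover have "h (dend_op b x y) = m b (h x) (h y)" for b x y
    by (induction x; induction y) (simp add: dend_op.abs_eq h_abs H_op)
  moreover have "h (dend_gen v) = f v" for v
    by (simp add: dend_gen.abs_eq h_abs) (simp add: H_def generator_def vs)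
  ultimately show "\<exists>h. dendriform_hom scale succ prec h \<and> (\<forall>v. h (dend_gen v) = f v)"
    by (intro exI[of _ h]) (simp add: dendriform_hom_def)
next
  interpret D: dendriform_algebra scale succ prec by fact
  have vs: "vector_space scale" by (rule D.vector_space_axioms)
  fix g h :: "('v, 'f) free_dendriform \<Rightarrow> 'a"
  assume g: "dendriform_hom scale succ prec g \<and> (\<forall>v. g (dend_gen v) = f v)"
    and h: "dendriform_hom scale succ prec h \<and> (\<forall>v. h (dend_gen v) = f v)"
  have op: "k (dend_op b x y) = (case b of Succ \<Rightarrow> succ | Prec \<Rightarrow> prec) (k x) (k y)"
    if "dendriform_hom scale succ prec k" for k :: "('v, 'f) free_dendriform \<Rightarrow> 'a" and b x y
    using that by (cases b) (auto simp: dendriform_hom_def)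
  have lin: "Vector_Spaces.linear smul scale (\<lambda>p. k (abs_free_dendriform p))"
    if "dendriform_hom scale succ prec k" for k :: "('v, 'f) free_dendriform \<Rightarrow> 'a"
  proof (rule linearI[OF vector_space_smul vs])
    interpret Vector_Spaces.linear dend_scale scale k
      using that by (simp add: dendriform_hom_def)
    fix p q c
    show "k (abs_free_dendriform (p + q)) = k (abs_free_dendriform p) + k (abs_free_dendriform q)"
      by (simp flip: plus_free_dendriform.abs_eq add: add)
    show "k (abs_free_dendriform (smul c p)) = scale c (k (abs_free_dendriform p))"
      by (simp flip: dend_scale.abs_eq add: scale)
  qed
  have "g (abs_free_dendriform (Poly_Mapping.single t 1)) = h (abs_free_dendriform (Poly_Mapping.single t 1))" for t
  proof (induction t)
    case (Gen v)
    have "abs_free_dendriform (Poly_Mapping.single (Gen v) 1) = (dend_gen v :: ('v, 'f) free_dendriform)"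
      by (simp add: dend_gen.abs_eq generator_def)
    then show ?case using g h by simp
  next
    case (Op b s t)
    have "abs_free_dendriform (Poly_Mapping.single (Op b s t) 1 :: (dendriform_op, 'v, 'f) free_algebra)
      = dend_op b (abs_free_dendriform (Poly_Mapping.single s 1)) (abs_free_dendriform (Poly_Mapping.single t 1))"
      by (simp add: dend_op.abs_eq)
    then show ?case using g h Op by (simp add: op)
  qed
  then have "g (abs_free_dendriform p) = h (abs_free_dendriform p)" for p
    using linear_extension_unique[OF lin[of g], of p] linear_extension_unique[OF lin[of h], of p] g h
    by simp
  then have "g x = h x" for x by (induction x) simp
  then show "g = h" by blast
qed

definition dend_multilinear :: "('v::finite, 'f::field) free_dendriform set" where
  "dend_multilinear = abs_free_dendriform ` multilinear"


section \<open>The expansion map\<close>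

text \<open>The operation type \<open>unit\<close> gives the free nonassociative algebra with a single product.\<close>

type_synonym ('v, 'f) free_nonassoc = "(unit, 'v, 'f) free_algebra"

primrec expand_monomial :: "(unit, 'v) monomial \<Rightarrow> ('v, 'f::field) free_dendriform" where
  "expand_monomial (Gen v) = dend_gen v"
| "expand_monomial (Op b s t) =
     expand_monomial s \<succ>\<^sub>D expand_monomial t + expand_monomial t \<prec>\<^sub>D expand_monomial s"

definition expansion :: "('v, 'f::field) free_nonassoc \<Rightarrow> ('v, 'f) free_dendriform" where
  "expansion = linear_extension dend_scale expand_monomial"

lemma linear_expansion: "Vector_Spaces.linear smul dend_scale expansion"
  unfolding expansion_def by (rule linear_linear_extension[OF vector_space_dend_scale])

lemma expansion_generator: "expansion (generator v) = dend_gen v"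
  using vector_space.vector_space_assms(4)[OF vector_space_dend_scale]
  by (simp add: expansion_def generator_def vector_space_dend_scale)

lemma expansion_product: "expansion (operation b p q)
    = expansion p \<succ>\<^sub>D expansion q + expansion q \<prec>\<^sub>D expansion p"
  unfolding expansion_def
proof (rule linear_extension_operation[OF vector_space_dend_scale])
  fix x y :: "('a, 'b) free_dendriform"
  note L = Vector_Spaces.linear.axioms(3)[OF linear_dend_op_left]
  note R = Vector_Spaces.linear.axioms(3)[OF linear_dend_op_right]
  note simps = module_hom.add[OF L] module_hom.add[OF R] module_hom.scale[OF L] module_hom.scale[OF R]
    vector_space.vector_space_assms(1)[OF vector_space_dend_scale]
  show "Vector_Spaces.linear dend_scale dend_scale (\<lambda>x. x \<succ>\<^sub>D y + y \<prec>\<^sub>D x)"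
    by (rule linearI[OF vector_space_dend_scale vector_space_dend_scale]) (simp_all add: simps)
  show "Vector_Spaces.linear dend_scale dend_scale (\<lambda>y. x \<succ>\<^sub>D y + y \<prec>\<^sub>D x)"
    by (rule linearI[OF vector_space_dend_scale vector_space_dend_scale]) (simp_all add: simps)
qed simp

lemma expand_monomial_gens:
  fixes t :: "(unit, 'v) monomial"
  shows "\<exists>p :: (dendriform_op, 'v, 'f::field) free_algebra. expand_monomial t = abs_free_dendriform p
    \<and> (\<forall>k\<in>Poly_Mapping.keys p. gens k = gens t)"
proof (induction t)
  case (Gen v)
  show ?case
    by (rule exI[of _ "generator v"]) (auto simp: dend_gen.abs_eq generator_def)
next
  case (Op b s t)
  from Op.IH(1) obtain p :: "(dendriform_op, 'v, 'f) free_algebra" where p: "expand_monomial s = abs_free_dendriform p"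
      "\<forall>k\<in>Poly_Mapping.keys p. gens k = gens s"
    by (elim exE conjE)
  from Op.IH(2) obtain q :: "(dendriform_op, 'v, 'f) free_algebra" where q: "expand_monomial t = abs_free_dendriform q"
      "\<forall>k\<in>Poly_Mapping.keys q. gens k = gens t"
    by (elim exE conjE)
  have keys_op: "gens k = S + T" if "k \<in> Poly_Mapping.keys (operation c x y)"
    "\<forall>k\<in>Poly_Mapping.keys x. gens k = S" "\<forall>k\<in>Poly_Mapping.keys y. gens k = T"
    for c S T k and x y :: "(dendriform_op, 'v, 'f) free_algebra"
  proof -
    have "Poly_Mapping.lookup (operation c x y) k \<noteq> 0"
      using that(1) by (simp add: in_keys_iff)
    then obtain s' where s': "s' \<in> Poly_Mapping.keys x"
      "Poly_Mapping.lookup (linear_extension smul (\<lambda>t. Poly_Mapping.single (Op c s' t) 1) y) k \<noteq> 0"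
      unfolding operation_def linear_extension_def[of _ _ x] lookup_sum
      by (metis (no_types, lifting) lookup_smul mult_zero_right sum.neutral)
    then obtain t' where t': "t' \<in> Poly_Mapping.keys y"
      "Poly_Mapping.lookup (Poly_Mapping.single (Op c s' t') (1 :: 'f)) k \<noteq> 0"
      unfolding linear_extension_def lookup_sum
      by (metis (no_types, lifting) lookup_smul mult_zero_right sum.neutral)
    then have "k = Op c s' t'" by (auto simp: lookup_single when_def split: if_splits)
    then show ?thesis using that s' t' by simp
  qed
  show ?case
  proof (intro exI[of _ "operation Succ p q + operation Prec q p"] conjI ballI)
    show "expand_monomial (Op b s t) = abs_free_dendriform (operation Succ p q + operation Prec q p)"
      by (simp add: p q dend_op.abs_eq plus_free_dendriform.abs_eq)
    fix k assume "k \<in> Poly_Mapping.keys (operation Succ p q + operation Prec q p)"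
    then consider "k \<in> Poly_Mapping.keys (operation Succ p q)"
      | "k \<in> Poly_Mapping.keys (operation Prec q p)"
      by (auto dest: subsetD[OF keys_add])
    then show "gens k = gens (Op b s t)"
      using keys_op[OF _ p(2) q(2)] keys_op[OF _ q(2) p(2)] by cases (simp_all add: add.commute)
  qed
qed

lemma expansion_multilinear: "expansion ` multilinear \<subseteq> dend_multilinear"
proof
  fix x assume "x \<in> (expansion ` multilinear :: ('a, 'b) free_dendriform set)"
  then obtain p :: "('a, 'b) free_nonassoc" where p: "p \<in> multilinear" "x = expansion p" by blast
  obtain e :: "(unit, 'a) monomial \<Rightarrow> (dendriform_op, 'a, 'b) free_algebra"
    where e: "\<And>t. expand_monomial t = abs_free_dendriform (e t)"
      "\<And>t k. k \<in> Poly_Mapping.keys (e t) \<Longrightarrow> gens k = gens t"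
    using expand_monomial_gens by metis
  have abs_sum: "abs_free_dendriform (\<Sum>t\<in>A. g t) = (\<Sum>t\<in>A. abs_free_dendriform (g t))"
    if "finite A" for A and g :: "(unit, 'a) monomial \<Rightarrow> (dendriform_op, 'a, 'b) free_algebra"
    using that by induction (simp_all add: zero_free_dendriform.abs_eq flip: plus_free_dendriform.abs_eq)
  define q where "q = (\<Sum>t\<in>Poly_Mapping.keys p. smul (Poly_Mapping.lookup p t) (e t))"
  have "x = abs_free_dendriform q"
    by (simp add: p q_def expansion_def linear_extension_def e(1) abs_sum dend_scale.abs_eq)
  moreover have "q \<in> multilinear"
    unfolding multilinear_def
  proof (intro CollectI ballI)
    fix k assume "k \<in> Poly_Mapping.keys q"
    then have "Poly_Mapping.lookup q k \<noteq> 0" by (simp add: in_keys_iff)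
    then obtain t where t: "t \<in> Poly_Mapping.keys p" "Poly_Mapping.lookup (e t) k \<noteq> 0"
      unfolding q_def lookup_sum by (metis (no_types, lifting) lookup_smul mult_zero_right sum.neutral)
    then have "gens k = gens t" using e(2) by (simp add: in_keys_iff)
    then show "\<forall>v. count (gens k) v = 1" using p t by (simp add: multilinear_def)
  qed
  ultimately show "x \<in> dend_multilinear" by (auto simp: dend_multilinear_def)
qed

text \<open>The multilinear identities, of degree the number of elements of \<open>'v\<close>, satisfied by the
  pre-Jordan product.\<close>

definition pre_Jordan_identities :: "('v::finite, 'f::field) free_nonassoc set" where
  "pre_Jordan_identities = {p \<in> multilinear. expansion p = 0}"

end

theory Submission
  imports Defs
begin

text \<open>To show that an element of the free dendriform algebra is nonzero it suffices to find a
  dendriform algebra in which its image is nonzero. The one used here is the algebra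
  of words over \<open>\<nat>\<close>, with the concatenation \<open>u @ v\<close> split between the two
  operations: it is \<open>u \<succ> v\<close> if the largest letter of \<open>v\<close> exceeds that of \<open>u\<close>, and
  \<open>u \<prec> v\<close> otherwise. The three axioms hold because associativity of concatenation splits
  into cases according to which of three factors has the largest letter
  (\<open>dendriform_algebra_words\<close>).

  If \<open>u\<close> and \<open>v\<close> are nonempty and have no common letter, then \<open>u \<succ> v + v \<prec> u\<close> is the
  Jordan product \<open>u @ v + v @ u\<close> when the largest letter is in \<open>v\<close>, and it is \<open>0\<close> when
  that letter is in \<open>u\<close>. So, if the generators are sent to distinct letters with
  \<open>x < y < z\<close>, all but three multilinear monomials of degree three vanish. The
  others are \<open>(x \<cdot> y) \<cdot> z\<close>, \<open>x \<cdot> (y \<cdot> z)\<close> and \<open>y \<cdot> (x \<cdot> z)\<close>, and they become the three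
  multilinear Jordan monomials in \<open>x, y, z\<close>:
    \<^item> \<open>(x \<cdot> y) \<cdot> z\<close> becomes \<open>xyz + yxz + zxy + zyx\<close>,
    \<^item> \<open>x \<cdot> (y \<cdot> z)\<close> becomes \<open>xyz + xzy + yzx + zyx\<close>,
    \<^item> \<open>y \<cdot> (x \<cdot> z)\<close> becomes \<open>yxz + yzx + xzy + zxy\<close>.
  These are linearly independent when \<open>2 \<noteq> 0\<close>, so in an identity the coefficients of the
  three monomials are \<open>0\<close> (\<open>degree_3_coefficients_vanish\<close>). Every multilinear monomial of degree
  three is one of the first two for some order of the generators, so every identity is \<open>0\<close>.\<close>

section \<open>A dendriform algebra of words\<close>

text \<open>The empty word gets the value \<open>0\<close>, which is neutral for \<open>max\<close> on \<open>\<nat>\<close>; thus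
  \<open>top_letter\<close> turns concatenation into \<open>max\<close> for all words.\<close>

definition top_letter :: "nat list \<Rightarrow> nat" where
  "top_letter w = foldr max w 0"

lemma top_letter_Nil [simp]: "top_letter [] = 0"
  and top_letter_Cons [simp]: "top_letter (n # w) = max n (top_letter w)"
  by (simp_all add: top_letter_def)

lemma top_letter_append [simp]: "top_letter (u @ v) = max (top_letter u) (top_letter v)"
  by (induction u) simp_all

definition word_product :: "(nat \<Rightarrow> nat \<Rightarrow> bool) \<Rightarrow> (nat list \<Rightarrow>\<^sub>0 'f::field) \<Rightarrow> (nat list \<Rightarrow>\<^sub>0 'f)
    \<Rightarrow> (nat list \<Rightarrow>\<^sub>0 'f)" where
  "word_product R p q = linear_extension smul (\<lambda>u. linear_extension smul
     (\<lambda>v. if R (top_letter u) (top_letter v) then Poly_Mapping.single (u @ v) 1 else 0) q) p"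

abbreviation word_succ (infixl \<open>\<succ>\<^sub>W\<close> 70) where "p \<succ>\<^sub>W q \<equiv> word_product (<) p q"
abbreviation word_prec (infixl \<open>\<prec>\<^sub>W\<close> 70) where "p \<prec>\<^sub>W q \<equiv> word_product (\<ge>) p q"

lemma smul_single: "smul c (Poly_Mapping.single k d) = Poly_Mapping.single k (c * d)"
  by (rule poly_mapping_eqI) (simp add: lookup_single when_def)

lemma word_product_single [simp]:
  "word_product R (Poly_Mapping.single u c) (Poly_Mapping.single v d)
     = (if R (top_letter u) (top_letter v) then Poly_Mapping.single (u @ v) (c * d) else 0)"
  by (simp add: word_product_def vector_space_smul smul_single)

lemma linear_word_product_left: "Vector_Spaces.linear smul smul (\<lambda>p. word_product R p q)"
  unfolding word_product_def by (rule linear_linear_extension[OF vector_space_smul])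

lemma linear_word_product_right: "Vector_Spaces.linear smul smul (word_product R p)"
proof (rule linearI[OF vector_space_smul vector_space_smul])
  note hom = Vector_Spaces.linear.axioms(3)[OF linear_linear_extension[OF vector_space_smul]]
  fix q r c
  show "word_product R p (q + r) = word_product R p q + word_product R p r"
    by (simp add: word_product_def module_hom.add[OF hom],
        simp add: linear_extension_def smul.scale_right_distrib sum.distrib)
  show "word_product R p (smul c q) = smul c (word_product R p q)"
    by (simp add: word_product_def module_hom.scale[OF hom],
        simp add: linear_extension_def smul.scale_sum_right mult.left_commute)
qed

lemmas word_product_add [simp] =
  module_hom.add[OF Vector_Spaces.linear.axioms(3)[OF linear_word_product_left]]
  module_hom.add[OF Vector_Spaces.linear.axioms(3)[OF linear_word_product_right]]

lemmas word_product_zero [simp] =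
  module_hom.zero[OF Vector_Spaces.linear.axioms(3)[OF linear_word_product_left]]
  module_hom.zero[OF Vector_Spaces.linear.axioms(3)[OF linear_word_product_right]]

lemma poly_mapping_additive_induct [case_names single add]:
  assumes single: "\<And>k c. P (Poly_Mapping.single k c)"
    and add: "\<And>p q. P p \<Longrightarrow> P q \<Longrightarrow> P (p + q)"
  shows "P (p :: 'k \<Rightarrow>\<^sub>0 'f::comm_monoid_add)"
proof (induction p rule: update_induct)
  case const
  show ?case using single[of undefined 0] by simp
next
  case (update p k c)
  have "Poly_Mapping.update k c p = Poly_Mapping.single k c + p"
    using update.hyps(1)
    by (intro poly_mapping_eqI)
       (auto simp: lookup_update lookup_add lookup_single when_def in_keys_iff)
  then show ?case using single add update.IH by simp
qed

text \<open>Additivity suffices because the basis vectors are tested with all their scalar multiples.\<close>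

lemma triadditive_eqI:
  fixes T T' :: "('k \<Rightarrow>\<^sub>0 'f::field) \<Rightarrow> ('k \<Rightarrow>\<^sub>0 'f) \<Rightarrow> ('k \<Rightarrow>\<^sub>0 'f) \<Rightarrow> 'a::ab_group_add"
  assumes "\<And>p p' q r. T (p + p') q r = T p q r + T p' q r"
    and "\<And>p q q' r. T p (q + q') r = T p q r + T p q' r"
    and "\<And>p q r r'. T p q (r + r') = T p q r + T p q r'"
    and "\<And>p p' q r. T' (p + p') q r = T' p q r + T' p' q r"
    and "\<And>p q q' r. T' p (q + q') r = T' p q r + T' p q' r"
    and "\<And>p q r r'. T' p q (r + r') = T' p q r + T' p q r'"
    and single: "\<And>u v w c d e. T (Poly_Mapping.single u c) (Poly_Mapping.single v d) (Poly_Mapping.single w e)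
      = T' (Poly_Mapping.single u c) (Poly_Mapping.single v d) (Poly_Mapping.single w e)"
  shows "T p q r = T' p q r"
proof (induction p rule: poly_mapping_additive_induct)
  case (single u c)
  show ?case
  proof (induction q rule: poly_mapping_additive_induct)
    case (single v d)
    show ?case
      by (induction r rule: poly_mapping_additive_induct) (simp_all add: assms)
  qed (simp add: assms)
qed (simp add: assms)

text \<open>On words with largest letters \<open>k, l, m\<close>, each side of an axiom is the concatenation of all
  three under a condition on \<open>k, l, m\<close>, and the conditions on the two sides agree: they are
  \<open>l \<le> k \<and> m \<le> k\<close> for \<open>prec_prec\<close>, \<open>k < l \<and> m \<le> l\<close> for \<open>succ_prec\<close>,
  and \<open>k < m \<and> l < m\<close> for \<open>succ_succ\<close>. In the axioms with a sum, the two summands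
  distinguish how the other two letters compare. Counting a tie as \<open>\<prec>\<close>
  is what makes this a partition of all cases.\<close>

theorem dendriform_algebra_words:
  "dendriform_algebra (smul :: 'f::field \<Rightarrow> (nat list \<Rightarrow>\<^sub>0 'f) \<Rightarrow> _) (\<succ>\<^sub>W) (\<prec>\<^sub>W)"
proof (intro dendriform_algebra.intro dendriform_algebra_axioms.intro vector_space_smul
    linear_word_product_left linear_word_product_right)
  fix p q r :: "nat list \<Rightarrow>\<^sub>0 'f"
  show "(p \<prec>\<^sub>W q) \<prec>\<^sub>W r = p \<prec>\<^sub>W (q \<prec>\<^sub>W r) + p \<prec>\<^sub>W (q \<succ>\<^sub>W r)"
    by (rule triadditive_eqI[where T = "\<lambda>p q r. (p \<prec>\<^sub>W q) \<prec>\<^sub>W r"]) (auto simp: mult.assoc)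
  show "(p \<succ>\<^sub>W q) \<prec>\<^sub>W r = p \<succ>\<^sub>W (q \<prec>\<^sub>W r)"
    by (rule triadditive_eqI[where T = "\<lambda>p q r. (p \<succ>\<^sub>W q) \<prec>\<^sub>W r"]) (auto simp: mult.assoc)
  show "p \<succ>\<^sub>W (q \<succ>\<^sub>W r) = (p \<prec>\<^sub>W q) \<succ>\<^sub>W r + (p \<succ>\<^sub>W q) \<succ>\<^sub>W r"
    by (rule triadditive_eqI[where T = "\<lambda>p q r. p \<succ>\<^sub>W (q \<succ>\<^sub>W r)"]) (auto simp: mult.assoc)
qed

section \<open>Evaluating nonassociative polynomials in words\<close>

abbreviation (input) nonassoc_product (infixl \<open>\<cdot>\<close> 70) where "s \<cdot> t \<equiv> Op () s t"

text \<open>The value of a monomial under the pre-Jordan product of words, where the generator \<open>v\<close> is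
  the one-letter word \<open>[r v]\<close>. The map \<open>r\<close> thus encodes an order of the generators.\<close>

primrec word_value :: "('v \<Rightarrow> nat) \<Rightarrow> (unit, 'v) monomial \<Rightarrow> (nat list \<Rightarrow>\<^sub>0 'f::field)" where
  "word_value r (Gen v) = Poly_Mapping.single [r v] 1"
| "word_value r (Op b s t) =
     word_value r s \<succ>\<^sub>W word_value r t + word_value r t \<prec>\<^sub>W word_value r s"

text \<open>By the universal property, evaluation in words factors through the free dendriform algebra,
  so an identity of the pre-Jordan product also holds for words.\<close>

lemma word_value_vanishes:
  fixes p :: "('v, 'f::field) free_nonassoc"
  assumes "expansion p = 0"
  shows "linear_extension smul (word_value r) p = 0"
proof -
  obtain h :: "('v, 'f) free_dendriform \<Rightarrow> (nat list \<Rightarrow>\<^sub>0 'f)"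
    where hom: "dendriform_hom smul (\<succ>\<^sub>W) (\<prec>\<^sub>W) h"
      and gen: "\<And>v. h (dend_gen v) = Poly_Mapping.single [r v] 1"
    using free_dendriform_universal[OF dendriform_algebra_words,
        of "\<lambda>v. Poly_Mapping.single [r v] 1"] by metis
  from hom interpret h: Vector_Spaces.linear dend_scale smul h
    by (simp add: dendriform_hom_def)
  have "h (expand_monomial t) = word_value r t" for t
    by (induction t) (use hom gen in \<open>auto simp: dendriform_hom_def h.add\<close>)
  then have "h (expansion p) = linear_extension smul (word_value r) p"
    by (simp add: expansion_def linear_extension_def h.sum h.scale)
  then show ?thesis
    by (simp add: assms h.zero)
qed

section \<open>Degree three\<close>

lemma size_gens_pos: "0 < size (gens t)"
  by (induction t) simp_all

lemma degree_3_monomial_cases: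
  fixes t :: "(unit, 'v::finite) monomial"
  assumes card: "CARD('v) = 3" and t: "\<And>v. count (gens t) v = 1"
  obtains a b c where "distinct [a, b, c]" "t = Gen a \<cdot> Gen b \<cdot> Gen c"
  | a b c where "distinct [a, b, c]" "t = Gen a \<cdot> (Gen b \<cdot> Gen c)"
proof -
  have "gens t = mset_set UNIV"
    by (rule multiset_eqI) (simp add: t)
  with card have size: "size (gens t) = 3" by simp
  have le1: "count (gens t) v \<le> 1" for v by (simp add: t)
  have one: "\<exists>v. s = Gen v" if "size (gens s) = 1" for s :: "(unit, 'v) monomial"
  proof (cases s)
    case (Op b s1 s2)
    then show ?thesis using that size_gens_pos[of s1] size_gens_pos[of s2] by simp
  qed simp
  have two: "\<exists>u v. s = Gen u \<cdot> Gen v" if "size (gens s) = 2" for s :: "(unit, 'v) monomial"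
  proof (cases s)
    case (Op b s1 s2)
    then have "size (gens s1) = 1" "size (gens s2) = 1"
      using that size_gens_pos[of s1] size_gens_pos[of s2] by simp_all
    then show ?thesis using Op one[of s1] one[of s2] by auto
  qed (use that in simp)
  show thesis
  proof (cases t)
    case (Op b s1 s2)
    then have "size (gens s1) = 2 \<and> size (gens s2) = 1 \<or> size (gens s1) = 1 \<and> size (gens s2) = 2"
      using size size_gens_pos[of s1] size_gens_pos[of s2] by auto
    then consider (l) x y z where "t = Gen x \<cdot> Gen y \<cdot> Gen z"
      | (r) x y z where "t = Gen x \<cdot> (Gen y \<cdot> Gen z)"
      using Op one[of s1] one[of s2] two[of s1] two[of s2] by auto
    then show thesis
    proof cases
      case l
      have "distinct [x, y, z]"
        using le1[of x] le1[of y] l by (auto split: if_splits)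
      then show thesis using l that(1) by blast
    next
      case r
      have "distinct [x, y, z]"
        using le1[of x] le1[of y] r by (auto split: if_splits)
      then show thesis using r that(2) by blast
    qed
  qed (use size in simp)
qed

text \<open>Each triple \<open>x, y, z\<close> is tested with the order of the generators in which
  \<open>x < y < z\<close>, which annihilates all monomials except for the two in question and
  \<open>y \<cdot> (x \<cdot> z)\<close>.\<close>

lemma degree_3_coefficients_vanish:
  fixes p :: "('v::finite, 'f::field_char_0) free_nonassoc"
  assumes card: "CARD('v) = 3" and p: "p \<in> multilinear" "expansion p = 0"
    and xyz: "distinct [x, y, z]"
  shows "Poly_Mapping.lookup p (Gen x \<cdot> Gen y \<cdot> Gen z) = 0"
    and "Poly_Mapping.lookup p (Gen x \<cdot> (Gen y \<cdot> Gen z)) = 0"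
proof -
  have ne: "x \<noteq> y" "x \<noteq> z" "y \<noteq> z" using xyz by auto
  have "card {x, y, z} = CARD('v)" using card ne by simp
  then have UNIV: "UNIV = {x, y, z}" by (metis card_subset_eq finite subset_UNIV)
  then have xyz_cases: "v = x \<or> v = y \<or> v = z" for v by blast
  define r where "r v = (if v = x then 0 else if v = y then 1 else 2 :: nat)" for v
  have r [simp]: "r x = 0" "r y = 1" "r z = 2" using ne by (simp_all add: r_def)
  let ?l = "Gen x \<cdot> Gen y \<cdot> Gen z" and ?m = "Gen x \<cdot> (Gen y \<cdot> Gen z)"
    and ?n = "Gen y \<cdot> (Gen x \<cdot> Gen z)"
  let ?val = "word_value r :: (unit, 'v) monomial \<Rightarrow> nat list \<Rightarrow>\<^sub>0 'f"
  \<comment> \<open>In every other monomial some left factor has a larger letter than the right factor, so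
    that product vanishes.\<close>
  have other: "?val t = 0" if t: "t \<in> Poly_Mapping.keys p" "t \<notin> {?l, ?m, ?n}" for t
  proof -
    have "count (gens t) v = 1" for v using p(1) t(1) by (auto simp: multilinear_def)
    with card show ?thesis
    proof (cases rule: degree_3_monomial_cases)
      case (1 a b c)
      then show ?thesis
        using t(2) xyz_cases[of a] xyz_cases[of b] xyz_cases[of c] by auto
    next
      case (2 a b c)
      then show ?thesis
        using t(2) xyz_cases[of a] xyz_cases[of b] xyz_cases[of c] by auto
    qed
  qed
  have distinct: "?l \<noteq> ?m" "?l \<noteq> ?n" "?m \<noteq> ?n" using ne by simp_all
  have "0 = linear_extension smul ?val p"
    using word_value_vanishes[OF p(2)] by simp
  also have "\<dots> = (\<Sum>t\<in>{?l, ?m, ?n}. smul (Poly_Mapping.lookup p t) (?val t))"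
    unfolding linear_extension_def
    by (rule sum.mono_neutral_cong) (use other in \<open>auto simp: in_keys_iff\<close>)
  finally have "(\<Sum>t\<in>{?l, ?m, ?n}. smul (Poly_Mapping.lookup p t) (?val t)) = 0" ..
  then have "Poly_Mapping.lookup p ?l * Poly_Mapping.lookup (?val ?l) w
      + Poly_Mapping.lookup p ?m * Poly_Mapping.lookup (?val ?m) w
      + Poly_Mapping.lookup p ?n * Poly_Mapping.lookup (?val ?n) w = 0" for w
    using distinct by (simp add: poly_mapping_eq_iff lookup_add fun_eq_iff add.assoc)
  \<comment> \<open>The words \<open>xyz\<close>, \<open>yxz\<close> and \<open>xzy\<close>: each occurs in exactly two of the three Jordan monomials,
    and each pair of these monomials shares one of the words.\<close>
  note word = this[of "[0, 1, 2]"] this[of "[1, 0, 2]"] this[of "[0, 2, 1]"]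
  have eqs: "Poly_Mapping.lookup p ?l + Poly_Mapping.lookup p ?m = 0"
    "Poly_Mapping.lookup p ?l + Poly_Mapping.lookup p ?n = 0"
    "Poly_Mapping.lookup p ?m + Poly_Mapping.lookup p ?n = 0"
    using word by (simp_all add: lookup_add lookup_single)
  have "2 * Poly_Mapping.lookup p ?l = 0" using eqs by algebra
  then show "Poly_Mapping.lookup p ?l = 0" by simp
  with eqs(1) show "Poly_Mapping.lookup p ?m = 0" by simp
qed

lemma pre_Jordan_identities_degree_3:
  assumes "CARD('v::finite) = 3"
  shows "pre_Jordan_identities = {0 :: ('v, 'f::field_char_0) free_nonassoc}"
proof (intro equalityI subsetI)
  fix p :: "('v, 'f) free_nonassoc"
  assume "p \<in> pre_Jordan_identities"
  then have p: "p \<in> multilinear" "expansion p = 0" by (simp_all add: pre_Jordan_identities_def)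
  have "t \<notin> Poly_Mapping.keys p" for t
  proof
    assume t: "t \<in> Poly_Mapping.keys p"
    then have "count (gens t) v = 1" for v using p(1) by (auto simp: multilinear_def)
    with assms show False
      by (cases rule: degree_3_monomial_cases)
        (use t degree_3_coefficients_vanish[OF assms p] in \<open>auto simp: in_keys_iff\<close>)
  qed
  then show "p \<in> {0}" by (auto simp: in_keys_iff intro: poly_mapping_eqI)
next
  interpret Vector_Spaces.linear smul dend_scale "expansion :: ('v, 'f) free_nonassoc \<Rightarrow> _"
    by (rule linear_expansion)
  fix p :: "('v, 'f) free_nonassoc"
  assume "p \<in> {0}"
  then show "p \<in> pre_Jordan_identities"
    by (simp add: pre_Jordan_identities_def multilinear_def zero)
qed

theorem proposition3p1:
  shows "pre_Jordan_identities = {0 :: (3, 'f::field_char_0) free_nonassoc}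
    \<and> inj_on (expansion :: (3, 'f) free_nonassoc \<Rightarrow> (3, 'f) free_dendriform) multilinear"
proof
  show kernel: "pre_Jordan_identities = {0 :: (3, 'f) free_nonassoc}"
    by (rule pre_Jordan_identities_degree_3) simp
  interpret Vector_Spaces.linear smul dend_scale "expansion :: (3, 'f) free_nonassoc \<Rightarrow> _"
    by (rule linear_expansion)
  show "inj_on (expansion :: (3, 'f) free_nonassoc \<Rightarrow> (3, 'f) free_dendriform) multilinear"
  proof (rule inj_onI)
    fix p q :: "(3, 'f) free_nonassoc"
    assume "p \<in> multilinear" "q \<in> multilinear" "expansion p = expansion q"
    then have "p - q \<in> pre_Jordan_identities"
      using subsetD[OF keys_diff[of p q]] by (auto simp: pre_Jordan_identities_def multilinear_def diff)
    then have "p - q = 0" unfolding kernel by (rule singletonD)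
    then show "p = q" by simp
  qed
qed

end
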